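(* Let $G$ be a finite group and let $n$ be a positive integer such that $G$ can be generated by $n$ elements. Then the $n$th homogeneous cover $H(n,G)$ is homogeneous of rank $n$.
   Context: For a finite group $G$, $\Gamma_n(G)$ denotes the set of all sequences $(x_1,\ldots,x_n)\in G^n$ with $\langle x_1,\ldots,x_n\rangle=G$. $\operatorname{Aut}(G)$ acts on $\Gamma_n(G)$ by $f(x_1,\ldots,x_n)=(f(x_1),\ldots,f(x_n))$. A finite group $G$ is called homogeneous of rank $n$ if $\Gamma_n(G)\neq\emptyset$ and this action of $\operatorname{Aut}(G)$ on $\Gamma_n(G)$ is transitive. Let $F_n$ be the free group on $a_1,\ldots,a_n$. For $s=(x_1,\ldots,x_n)\in\Gamma_n(G)$ let $\pi_s:F_n\to G$ be the homomorphism with $\pi_s(a_i)=x_i$, and $K_s=\ker\pi_s$. If $G$ is finite and can be generated by $n$ elements, the $n$th homogeneous cover of $G$ is $H(n,G)=F_n/K$, where $K$ is the intersection of the kernels $K_s$ with $s$ running over a set of representatives of the $\operatorname{Aut}(G)$-orbits on $\Gamma_n(G)$ (equivalently, $K$ is the intersection of the kernels of all surjective homomorphisms $F_n\to G$). *)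

theory Defs
  imports "HOL-Algebra.Group_Action" "HOL-Algebra.Generated_Groups"
begin

section \<open>The free group of rank \<open>n\<close>\<close>

text \<open>The free generators are indexed by \<open>{..<n}\<close>. The letter \<open>(i, True)\<close> is the \<open>i\<close>-th generator and
  \<open>(i, False)\<close> its inverse. Group elements are the reduced words.\<close>

type_synonym letter = "nat \<times> bool"

definition inv_letter :: "letter \<Rightarrow> letter" where
  "inv_letter l = (fst l, \<not> snd l)"

definition reduced :: "letter list \<Rightarrow> bool" where
  "reduced w \<longleftrightarrow> successively (\<lambda>l m. m \<noteq> inv_letter l) w"

fun cons_reduced :: "letter \<Rightarrow> letter list \<Rightarrow> letter list" where
  "cons_reduced l [] = [l]"
| "cons_reduced l (m # w) = (if m = inv_letter l then w else l # m # w)"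

text \<open>The product of two reduced words is the reduced form of their concatenation; as the second word
  is already reduced, it suffices to prepend the letters of the first one, cancelling where possible.\<close>

definition free_group :: "nat \<Rightarrow> letter list monoid" where
  "free_group n =
     \<lparr>carrier = {w. reduced w \<and> fst ` set w \<subseteq> {..<n}},
      mult = (\<lambda>v w. foldr cons_reduced v w),
      one = []\<rparr>"

definition free_gen :: "nat \<Rightarrow> letter list" where
  "free_gen i = [(i, True)]"

lemma inv_letter_inv_letter [simp]: "inv_letter (inv_letter l) = l"
  by (simp add: inv_letter_def)

lemma reduced_Nil [simp]: "reduced []"
  by (simp add: reduced_def)

lemma reduced_Cons:
  "reduced (l # w) \<longleftrightarrow> (w = [] \<or> hd w \<noteq> inv_letter l) \<and> reduced w"
  by (cases w) (auto simp: reduced_def)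

lemma reduced_cons_reduced: "reduced w \<Longrightarrow> reduced (cons_reduced l w)"
  by (cases w) (auto simp: reduced_Cons)

lemma cons_reduced_eq_Cons: "reduced (l # w) \<Longrightarrow> cons_reduced l w = l # w"
  by (cases w) (auto simp: reduced_Cons)

lemma set_cons_reduced: "set (cons_reduced l w) \<subseteq> insert l (set w)"
  by (cases w) auto

lemma cons_reduced_cancel:
  "reduced w \<Longrightarrow> cons_reduced l (cons_reduced (inv_letter l) w) = w"
  by (cases w) (auto simp: cons_reduced_eq_Cons)

lemma reduced_foldr: "reduced w \<Longrightarrow> reduced (foldr cons_reduced v w)"
  by (induction v) (auto simp: reduced_cons_reduced)

lemma set_foldr_cons_reduced: "set (foldr cons_reduced v w) \<subseteq> set v \<union> set w"
  by (induction v) (use set_cons_reduced in fastforce)+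

lemma foldr_cons_reduced_step:
  assumes "reduced u"
  shows "foldr cons_reduced (cons_reduced l w) u = cons_reduced l (foldr cons_reduced w u)"
proof (cases w)
  case (Cons m w')
  have "reduced (foldr cons_reduced w' u)"
    using assms by (rule reduced_foldr)
  then show ?thesis
    using Cons by (auto simp: cons_reduced_cancel)
qed simp

lemma foldr_cons_reduced_assoc:
  assumes "reduced w"
  shows "foldr cons_reduced (foldr cons_reduced u v) w
    = foldr cons_reduced u (foldr cons_reduced v w)"
  by (induction u) (auto simp: foldr_cons_reduced_step assms)

lemma foldr_cons_reduced_Nil: "reduced w \<Longrightarrow> foldr cons_reduced w [] = w"
proof (induction w)
  case (Cons l w)
  then have "reduced w"
    by (simp add: reduced_Cons)
  with Cons show ?case
    by (simp add: cons_reduced_eq_Cons)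
qed simp

lemma foldr_cons_reduced_inverse:
  "reduced u \<Longrightarrow> foldr cons_reduced (map inv_letter (rev w)) (foldr cons_reduced w u) = u"
proof (induction w)
  case (Cons l w)
  have "reduced (foldr cons_reduced w u)"
    using Cons.prems by (rule reduced_foldr)
  then have "cons_reduced (inv_letter l) (cons_reduced l (foldr cons_reduced w u)) = foldr cons_reduced w u"
    using cons_reduced_cancel[of _ "inv_letter l"] by simp
  with Cons show ?case
    by simp
qed simp

lemma reduced_map_inv_letter_rev:
  assumes "reduced w"
  shows "reduced (map inv_letter (rev w))"
proof -
  have "successively (\<lambda>l m. inv_letter l \<noteq> m) w"
    using assms unfolding reduced_def by (rule successively_mono) auto
  then show ?thesis
    by (simp add: reduced_def successively_map)
qed

theorem group_free_group: "group (free_group n)"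
proof (rule groupI)
  fix u v assume *: "u \<in> carrier (free_group n)" "v \<in> carrier (free_group n)"
  have "fst ` set (foldr cons_reduced u v) \<subseteq> fst ` (set u \<union> set v)"
    using set_foldr_cons_reduced by (rule image_mono)
  also have "\<dots> \<subseteq> {..<n}"
    using * by (auto simp: free_group_def)
  finally show "u \<otimes>\<^bsub>free_group n\<^esub> v \<in> carrier (free_group n)"
    using * by (simp add: free_group_def reduced_foldr)
next
  fix w assume w: "w \<in> carrier (free_group n)"
  show "\<exists>v\<in>carrier (free_group n). v \<otimes>\<^bsub>free_group n\<^esub> w = \<one>\<^bsub>free_group n\<^esub>"
  proof (rule bexI)
    have "foldr cons_reduced (map inv_letter (rev w)) (foldr cons_reduced w []) = []"
      by (rule foldr_cons_reduced_inverse) simp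
    then show "map inv_letter (rev w) \<otimes>\<^bsub>free_group n\<^esub> w = \<one>\<^bsub>free_group n\<^esub>"
      using w by (simp add: free_group_def foldr_cons_reduced_Nil)
    show "map inv_letter (rev w) \<in> carrier (free_group n)"
      using w by (auto simp: free_group_def reduced_map_inv_letter_rev inv_letter_def)
  qed
qed (auto simp: free_group_def foldr_cons_reduced_assoc)


section \<open>Generating sequences and homogeneous groups\<close>

definition generating_sequences :: "nat \<Rightarrow> ('a, 'b) monoid_scheme \<Rightarrow> 'a list set" where
  "generating_sequences n G =
     {s. length s = n \<and> set s \<subseteq> carrier G \<and> generate G (set s) = carrier G}"

definition aut_action :: "nat \<Rightarrow> ('a, 'b) monoid_scheme \<Rightarrow> ('a \<Rightarrow> 'a) \<Rightarrow> 'a list \<Rightarrow> 'a list" where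
  "aut_action n G f = (\<lambda>s\<in>generating_sequences n G. map f s)"

definition homogeneous_of_rank :: "nat \<Rightarrow> ('a, 'b) monoid_scheme \<Rightarrow> bool" where
  "homogeneous_of_rank n G \<longleftrightarrow>
     group G \<and> finite (carrier G) \<and> generating_sequences n G \<noteq> {} \<and>
     transitive_action (AutoGroup G) (generating_sequences n G) (aut_action n G)"

definition orbit_representatives :: "nat \<Rightarrow> ('a, 'b) monoid_scheme \<Rightarrow> 'a list set \<Rightarrow> bool" where
  "orbit_representatives n G R \<longleftrightarrow>
     R \<subseteq> generating_sequences n G \<and>
     (\<forall>C \<in> orbits (AutoGroup G) (generating_sequences n G) (aut_action n G). \<exists>!s. s \<in> R \<inter> C)"


section \<open>The homogeneous cover\<close>

definition letter_value :: "('a, 'b) monoid_scheme \<Rightarrow> 'a list \<Rightarrow> letter \<Rightarrow> 'a" where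
  "letter_value G s l = (if snd l then s ! fst l else inv\<^bsub>G\<^esub> (s ! fst l))"

text \<open>The homomorphism \<open>\<pi>\<^sub>s\<close> from the free group to \<open>G\<close> that sends the \<open>i\<close>-th generator to \<open>s ! i\<close>.\<close>

definition proj_hom :: "('a, 'b) monoid_scheme \<Rightarrow> 'a list \<Rightarrow> letter list \<Rightarrow> 'a" where
  "proj_hom G s w = foldr (\<lambda>l x. letter_value G s l \<otimes>\<^bsub>G\<^esub> x) w \<one>\<^bsub>G\<^esub>"

definition cover_kernel :: "nat \<Rightarrow> ('a, 'b) monoid_scheme \<Rightarrow> 'a list set \<Rightarrow> letter list set" where
  "cover_kernel n G R = (\<Inter>s\<in>R. kernel (free_group n) G (proj_hom G s))"

text \<open>The cover is formed with respect to a set \<open>R\<close> of representatives of the automorphism orbits; by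
  \<open>cover_kernel_eq\<close> below it does not depend on the choice of \<open>R\<close>.\<close>

definition homogeneous_cover ::
    "nat \<Rightarrow> ('a, 'b) monoid_scheme \<Rightarrow> 'a list set \<Rightarrow> letter list set monoid" where
  "homogeneous_cover n G R = free_group n Mod cover_kernel n G R"


section \<open>Well-definedness\<close>

context group
begin

lemma letter_value_closed:
  assumes "set s \<subseteq> carrier G" "fst l < length s"
  shows "letter_value G s l \<in> carrier G"
proof -
  have "s ! fst l \<in> carrier G"
    using assms nth_mem by blast
  then show ?thesis
    by (simp add: letter_value_def)
qed

lemma proj_hom_closed:
  assumes "set s \<subseteq> carrier G" "fst ` set w \<subseteq> {..<length s}"
  shows "proj_hom G s w \<in> carrier G"
  using assms(2)
  by (induction w) (auto simp: proj_hom_def intro!: letter_value_closed[OF assms(1)])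

lemma proj_hom_cons_reduced:
  assumes s: "set s \<subseteq> carrier G" and "fst l < length s" "fst ` set w \<subseteq> {..<length s}"
  shows "proj_hom G s (cons_reduced l w) = letter_value G s l \<otimes> proj_hom G s w"
proof (cases w)
  case (Cons m w')
  have l: "letter_value G s l \<in> carrier G"
    using assms by (simp add: letter_value_closed)
  have x: "s ! fst l \<in> carrier G"
    using assms nth_mem by blast
  have w': "proj_hom G s w' \<in> carrier G"
    using assms Cons by (intro proj_hom_closed) auto
  have inv: "letter_value G s (inv_letter l) = inv (letter_value G s l)"
    using x by (simp add: letter_value_def inv_letter_def)
  have "letter_value G s l \<otimes> (inv (letter_value G s l) \<otimes> proj_hom G s w') = proj_hom G s w'"
    using l w' by (simp add: m_assoc[symmetric])
  then show ?thesis
    using Cons inv by (auto simp: proj_hom_def)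
qed (simp add: proj_hom_def)

lemma proj_hom_foldr:
  assumes s: "set s \<subseteq> carrier G"
    and "fst ` set v \<subseteq> {..<length s}" "fst ` set w \<subseteq> {..<length s}"
  shows "proj_hom G s (foldr cons_reduced v w) = proj_hom G s v \<otimes> proj_hom G s w"
  using assms(2)
proof (induction v)
  case Nil
  have "proj_hom G s w \<in> carrier G"
    using assms by (simp add: proj_hom_closed)
  then show ?case
    by (simp add: proj_hom_def)
next
  case (Cons l v)
  have "fst ` set (foldr cons_reduced v w) \<subseteq> fst ` (set v \<union> set w)"
    using set_foldr_cons_reduced by (rule image_mono)
  also have "\<dots> \<subseteq> {..<length s}"
    using Cons.prems assms by auto
  finally have "fst ` set (foldr cons_reduced v w) \<subseteq> {..<length s}" .
  then have "proj_hom G s (foldr cons_reduced (l # v) w)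
      = letter_value G s l \<otimes> (proj_hom G s v \<otimes> proj_hom G s w)"
    using Cons s by (simp add: proj_hom_cons_reduced)
  also have "\<dots> = letter_value G s l \<otimes> proj_hom G s v \<otimes> proj_hom G s w"
    using Cons.prems assms by (intro m_assoc[symmetric] letter_value_closed proj_hom_closed) auto
  finally show ?case
    by (simp add: proj_hom_def)
qed

theorem proj_hom_in_hom:
  assumes "length s = n" "set s \<subseteq> carrier G"
  shows "proj_hom G s \<in> hom (free_group n) G"
  using assms by (intro homI) (auto simp: free_group_def proj_hom_closed proj_hom_foldr)

lemma proj_hom_free_gen:
  assumes "set s \<subseteq> carrier G" "i < length s"
  shows "proj_hom G s (free_gen i) = s ! i"
proof -
  have "s ! i \<in> carrier G"
    using assms nth_mem by blast
  then show ?thesis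
    by (simp add: proj_hom_def free_gen_def letter_value_def)
qed

theorem proj_hom_unique:
  assumes h: "h \<in> hom (free_group n) G" and gens: "\<And>i. i < n \<Longrightarrow> h (free_gen i) = s ! i"
    and w: "w \<in> carrier (free_group n)"
  shows "h w = proj_hom G s w"
proof -
  interpret F: group "free_group n"
    by (rule group_free_group)
  interpret h: group_hom "free_group n" G h
    by unfold_locales (rule h)
  have letter: "h [l] = letter_value G s l" if "fst l < n" for l
  proof (cases "snd l")
    case True
    then show ?thesis
      using gens[OF that] by (simp add: letter_value_def free_gen_def prod_eq_iff) (metis prod.collapse)
  next
    case False
    have l: "l = (fst l, False)"
      using False by (metis prod.collapse)
    have "[l] \<otimes>\<^bsub>free_group n\<^esub> free_gen (fst l) = \<one>\<^bsub>free_group n\<^esub>"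
      by (subst l) (simp add: free_group_def free_gen_def inv_letter_def)
    moreover have "free_gen (fst l) \<in> carrier (free_group n)" "[l] \<in> carrier (free_group n)"
      using that by (auto simp: free_group_def free_gen_def reduced_Cons)
    ultimately have "[l] = inv\<^bsub>free_group n\<^esub> (free_gen (fst l))"
      by (metis F.inv_equality)
    then show ?thesis
      using \<open>free_gen (fst l) \<in> carrier (free_group n)\<close> gens[OF that] False
      by (simp add: letter_value_def)
  qed
  show ?thesis
    using w
  proof (induction w)
    case Nil
    show ?case
      using h.hom_one by (simp add: proj_hom_def free_group_def)
  next
    case (Cons l w)
    have w: "w \<in> carrier (free_group n)" and l: "[l] \<in> carrier (free_group n)"
      using Cons.prems by (auto simp: free_group_def reduced_Cons)
    have "l # w = [l] \<otimes>\<^bsub>free_group n\<^esub> w"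
      using Cons.prems by (simp add: free_group_def cons_reduced_eq_Cons)
    then have "h (l # w) = h [l] \<otimes> h w"
      using w l by simp
    also have "\<dots> = letter_value G s l \<otimes> proj_hom G s w"
      using Cons.IH[OF w] letter[of l] l by (auto simp: free_group_def)
    finally show ?case
      by (simp add: proj_hom_def)
  qed
qed

lemma map_auto_generating_sequences:
  assumes f: "f \<in> auto G" and s: "s \<in> generating_sequences n G"
  shows "map f s \<in> generating_sequences n G"
proof -
  have hom: "f \<in> hom G G" and bij: "f ` carrier G = carrier G"
    using f by (auto simp: auto_def Bij_def bij_betw_def)
  interpret f: group_hom G G f
    by unfold_locales (rule hom)
  have "generate G (f ` set s) = f ` generate G (set s)"
    using s f.generate_img[of "set s"] by (simp add: generating_sequences_def)
  then show ?thesis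
    using s bij by (auto simp: generating_sequences_def)
qed

theorem group_action_aut_action:
  "group_action (AutoGroup G) (generating_sequences n G) (aut_action n G)"
proof -
  let ?S = "generating_sequences n G"
  interpret A: group "AutoGroup G"
    by (rule AutoGroup)
  have carrier: "carrier (AutoGroup G) = auto G"
    by (simp add: AutoGroup_def)
  have sub: "set s \<subseteq> carrier G" if "s \<in> ?S" for s
    using that by (simp add: generating_sequences_def)
  have mult: "map (f \<otimes>\<^bsub>AutoGroup G\<^esub> g) s = map f (map g s)"
    if "f \<in> auto G" "g \<in> auto G" "s \<in> ?S" for f g s
    using that sub[OF that(3)]
    by (auto simp: AutoGroup_def BijGroup_def auto_def compose_def)
  have one: "map \<one>\<^bsub>AutoGroup G\<^esub> s = s" if "s \<in> ?S" for s
    using sub[OF that] by (intro map_idI) (auto simp: AutoGroup_def BijGroup_def)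
  have bij: "aut_action n G f \<in> Bij ?S" if f: "f \<in> auto G" for f
  proof -
    define g where "g = inv\<^bsub>AutoGroup G\<^esub> f"
    have g: "g \<in> auto G"
      using f A.inv_closed by (simp add: g_def carrier)
    have "map g (map f s) = s" "map f (map g s) = s" if "s \<in> ?S" for s
      using mult[OF g f that] mult[OF f g that] one[OF that] f
      by (simp_all add: g_def carrier)
    then have "bij_betw (aut_action n G f) ?S ?S"
      using map_auto_generating_sequences[OF f] map_auto_generating_sequences[OF g]
      by (intro bij_betw_byWitness[where f' = "map g"]) (auto simp: aut_action_def)
    then show ?thesis
      by (simp add: Bij_def aut_action_def)
  qed
  have "aut_action n G \<in> hom (AutoGroup G) (BijGroup ?S)"
  proof (rule homI)
    fix f g assume "f \<in> carrier (AutoGroup G)" "g \<in> carrier (AutoGroup G)"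
    then have fg: "f \<in> auto G" "g \<in> auto G"
      by (simp_all add: carrier)
    show "aut_action n G (f \<otimes>\<^bsub>AutoGroup G\<^esub> g)
        = aut_action n G f \<otimes>\<^bsub>BijGroup ?S\<^esub> aut_action n G g"
      using bij[OF fg(1)] bij[OF fg(2)] mult[OF fg] map_auto_generating_sequences[OF fg(2)]
      by (auto simp: BijGroup_def compose_def aut_action_def fun_eq_iff)
  qed (simp add: carrier BijGroup_def bij)
  then show ?thesis
    by (simp add: group_action_def group_hom_def group_hom_axioms_def A.group_axioms group_BijGroup)
qed

theorem orbit_representatives_exist: "\<exists>R. orbit_representatives n G R"
proof -
  let ?S = "generating_sequences n G"
  let ?O = "orbits (AutoGroup G) ?S (aut_action n G)"
  interpret group_action "AutoGroup G" ?S "aut_action n G"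
    by (rule group_action_aut_action)
  have part: "partition ?S ?O"
    by (rule orbit_partition)
  have nonempty: "C \<noteq> {}" if "C \<in> ?O" for C
    using that orbit_refl by (auto simp: orbits_def)
  have "(SOME s. s \<in> C) \<in> C" if "C \<in> ?O" for C
    using nonempty[OF that] by (simp add: some_in_eq)
  moreover have "C = D" if "C \<in> ?O" "D \<in> ?O" "s \<in> C" "s \<in> D" for C D s
    using part that unfolding partition_def by blast
  moreover have "C \<subseteq> ?S" if "C \<in> ?O" for C
    using part that unfolding partition_def by blast
  ultimately have "orbit_representatives n G ((\<lambda>C. SOME s. s \<in> C) ` ?O)"
    unfolding orbit_representatives_def
    by (intro conjI ballI ex1I) (blast | metis IntE IntI imageE imageI)+
  then show ?thesis
    by blast
qed

text \<open>Automorphic sequences have the same kernel, so the intersection over a set of representatives is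
  the intersection over all generating sequences.\<close>

theorem cover_kernel_eq:
  assumes "orbit_representatives n G R"
  shows "cover_kernel n G R = cover_kernel n G (generating_sequences n G)"
proof -
  let ?S = "generating_sequences n G"
  let ?K = "\<lambda>s. kernel (free_group n) G (proj_hom G s)"
  interpret group_action "AutoGroup G" ?S "aut_action n G"
    by (rule group_action_aut_action)
  have ker: "?K (map f s) = ?K s" if f: "f \<in> auto G" and s: "s \<in> ?S" for f s
  proof -
    have hom: "f \<in> hom G G" and inj: "inj_on f (carrier G)"
      using f by (auto simp: auto_def Bij_def bij_betw_def)
    have s': "length s = n" "set s \<subseteq> carrier G"
      using s by (auto simp: generating_sequences_def)
    have p: "proj_hom G s \<in> hom (free_group n) G"
      using s' by (rule proj_hom_in_hom)
    have "f (proj_hom G s w) = proj_hom G (map f s) w" if "w \<in> carrier (free_group n)" for w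
    proof -
      have "f \<circ> proj_hom G s \<in> hom (free_group n) G"
        using Group.hom_compose[OF p hom] .
      then show ?thesis
        using proj_hom_unique[of "f \<circ> proj_hom G s" n "map f s" w] that s'
        by (simp add: proj_hom_free_gen)
    qed
    moreover have "proj_hom G s w \<in> carrier G" if "w \<in> carrier (free_group n)" for w
      using p that by (simp add: hom_in_carrier)
    moreover have "f x = \<one> \<longleftrightarrow> x = \<one>" if "x \<in> carrier G" for x
      using inj that hom_one[OF hom group_axioms group_axioms] by (metis inj_onD one_closed)
    ultimately show ?thesis
      unfolding kernel_def by (metis (no_types, lifting))
  qed
  have "\<exists>r\<in>R. ?K s = ?K r" if s: "s \<in> ?S" for s
  proof -
    have "orbit (AutoGroup G) (aut_action n G) s \<in> orbits (AutoGroup G) ?S (aut_action n G)"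
      using s by (auto simp: orbits_def)
    then obtain r where r: "r \<in> R" "r \<in> orbit (AutoGroup G) (aut_action n G) s"
      using assms unfolding orbit_representatives_def by blast
    then obtain f where "f \<in> auto G" "r = map f s"
      using s by (auto simp: orbit_def aut_action_def AutoGroup_def)
    then show ?thesis
      using r ker s by metis
  qed
  moreover have "R \<subseteq> ?S"
    using assms by (simp add: orbit_representatives_def)
  ultimately show ?thesis
    unfolding cover_kernel_def by blast
qed

end

end

theory Submission
  imports Defs
begin

text \<open>
  Write \<open>F\<close> for the free group of rank \<open>n\<close> and \<open>H = F/K\<close> for the cover. Here \<open>K\<close> is the intersection
  of the kernels of all \<open>\<pi>\<^sub>t\<close>, where \<open>t\<close> runs over the generating sequences of \<open>G\<close> (by
  \<open>cover_kernel_eq\<close>, orbit representatives give the same intersection). In particular every \<open>\<pi>\<^sub>t\<close>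
  factors through a homomorphism \<open>\<phi>\<^sub>t\<close> from \<open>H\<close> onto \<open>G\<close>. The group \<open>H\<close> is finite, because a coset of
  \<open>K\<close> is determined by the values of the finitely many \<open>\<pi>\<^sub>t\<close> on it.

  The point is that every generating sequence \<open>s\<close> of \<open>H\<close> satisfies \<open>ker \<pi>\<^sub>s \<subseteq> K\<close>. Applying \<open>\<phi>\<^sub>t\<close> to
  the entries of \<open>s\<close> gives another generating sequence of \<open>G\<close>. Since \<open>s\<close> generates \<open>H\<close>, the resulting
  sequence determines \<open>\<phi>\<^sub>t\<close>, and hence \<open>t\<close>. So \<open>t \<mapsto> \<phi>\<^sub>t(s)\<close> is an injective map of the finite set of
  generating sequences of \<open>G\<close> to itself, and it must be surjective: every \<open>\<pi>\<^sub>u\<close> has the form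
  \<open>\<phi>\<^sub>t \<circ> \<pi>\<^sub>s\<close>, and is therefore trivial on \<open>ker \<pi>\<^sub>s\<close>. This is lemma \<open>kernel_le_of_lifts\<close>.

  Let \<open>r\<close> be the sequence of the cosets of the free generators, so that \<open>ker \<pi>\<^sub>r = K\<close>. The
  inclusion \<open>ker \<pi>\<^sub>s \<subseteq> ker \<pi>\<^sub>r\<close> yields an endomorphism of \<open>H\<close> that maps \<open>s\<close> to \<open>r\<close>; it is surjective
  because \<open>r\<close> generates \<open>H\<close>, and bijective because \<open>H\<close> is finite. So every generating sequence of
  \<open>H\<close> lies in the orbit of \<open>r\<close>.
\<close>

section \<open>Homomorphisms from the free group and generating sequences\<close>

lemma free_gen_closed: "i < n \<Longrightarrow> free_gen i \<in> carrier (free_group n)"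
  by (auto simp: free_group_def free_gen_def reduced_Cons)

lemma hom_factors_through_surjection:
  assumes "group F" "group H" "group G"
    and p: "p \<in> hom F H" and surj: "p ` carrier F = carrier H"
    and q: "q \<in> hom F G" and ker: "kernel F H p \<subseteq> kernel F G q"
  obtains f where "f \<in> hom H G" "\<And>w. w \<in> carrier F \<Longrightarrow> f (p w) = q w"
proof -
  interpret F: group F by fact
  interpret p: group_hom F H p
    using assms by (simp add: group_hom_def group_hom_axioms_def)
  interpret q: group_hom F G q
    using assms by (simp add: group_hom_def group_hom_axioms_def)
  define f where "f = (\<lambda>h. q (inv_into (carrier F) p h))"
  have eq: "q v = q w" if "v \<in> carrier F" "w \<in> carrier F" "p v = p w" for v w
  proof -
    have "v \<otimes>\<^bsub>F\<^esub> inv\<^bsub>F\<^esub> w \<in> kernel F H p"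
      using that by (simp add: kernel_def)
    then have "v \<otimes>\<^bsub>F\<^esub> inv\<^bsub>F\<^esub> w \<in> kernel F G q"
      using ker by blast
    then have "q v \<otimes>\<^bsub>G\<^esub> inv\<^bsub>G\<^esub> q w = \<one>\<^bsub>G\<^esub>"
      using that by (simp add: kernel_def)
    then show ?thesis
      using that by (metis q.H.inv_solve_right' q.H.l_one q.H.one_closed q.hom_closed)
  qed
  have f: "f (p w) = q w" if "w \<in> carrier F" for w
    unfolding f_def using that
    by (intro eq) (auto simp: inv_into_into f_inv_into_f)
  have "f \<in> hom H G"
  proof (rule homI)
    fix x y assume "x \<in> carrier H" "y \<in> carrier H"
    then obtain v w where vw: "v \<in> carrier F" "w \<in> carrier F" "x = p v" "y = p w"
      using surj by blast
    then have "x \<otimes>\<^bsub>H\<^esub> y = p (v \<otimes>\<^bsub>F\<^esub> w)"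
      by simp
    then show "f (x \<otimes>\<^bsub>H\<^esub> y) = f x \<otimes>\<^bsub>G\<^esub> f y"
      using vw f[of v] f[of w] f[of "v \<otimes>\<^bsub>F\<^esub> w"] by simp
  next
    fix x assume "x \<in> carrier H"
    then show "f x \<in> carrier G"
      using surj f q.hom_closed by (metis imageE)
  qed
  then show thesis
    using f that by blast
qed

lemma hom_map_generating_sequences:
  assumes "group H" "group G" and f: "f \<in> hom H G" and surj: "f ` carrier H = carrier G"
    and s: "s \<in> generating_sequences n H"
  shows "map f s \<in> generating_sequences n G"
proof -
  interpret f: group_hom H G f
    using assms by (simp add: group_hom_def group_hom_axioms_def)
  have "generate G (f ` set s) = f ` generate H (set s)"
    using s f.generate_img[of "set s"] by (simp add: generating_sequences_def)
  then show ?thesis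
    using s surj by (auto simp: generating_sequences_def)
qed

context group
begin

lemma finite_generating_sequences:
  "finite (carrier G) \<Longrightarrow> finite (generating_sequences n G)"
  by (rule finite_subset[OF _ finite_lists_length_eq[of "carrier G" n]])
    (auto simp: generating_sequences_def)

lemma proj_hom_image:
  assumes s: "length s = n" "set s \<subseteq> carrier G"
  shows "proj_hom G s ` carrier (free_group n) = generate G (set s)"
proof
  have "proj_hom G s w \<in> generate G (set s)" if "fst ` set w \<subseteq> {..<n}" for w
    using that
  proof (induction w)
    case Nil
    show ?case
      by (simp add: proj_hom_def generate.one)
  next
    case (Cons l w)
    then have "s ! fst l \<in> set s"
      using s by simp
    then have "letter_value G s l \<in> generate G (set s)"
      by (simp add: letter_value_def generate.incl generate.inv)
    with Cons show ?case
      by (simp add: proj_hom_def generate.eng)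
  qed
  then show "proj_hom G s ` carrier (free_group n) \<subseteq> generate G (set s)"
    by (auto simp: free_group_def)
next
  interpret p: group_hom "free_group n" G "proj_hom G s"
    by (simp add: group_hom_def group_hom_axioms_def group_free_group group_axioms
        proj_hom_in_hom[OF s])
  have "set s \<subseteq> proj_hom G s ` carrier (free_group n)"
  proof
    fix x assume "x \<in> set s"
    then obtain i where "i < n" "x = s ! i"
      using s by (auto simp: in_set_conv_nth)
    then show "x \<in> proj_hom G s ` carrier (free_group n)"
      using proj_hom_free_gen[of s i] s free_gen_closed by (metis imageI)
  qed
  then show "generate G (set s) \<subseteq> proj_hom G s ` carrier (free_group n)"
    by (rule generate_subgroup_incl) (rule p.img_is_subgroup)
qed

lemma proj_hom_surj:
  "s \<in> generating_sequences n G \<Longrightarrow> proj_hom G s ` carrier (free_group n) = carrier G"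
  using proj_hom_image[of s n] by (simp add: generating_sequences_def)

lemma proj_hom_map:
  assumes "group H" and f: "f \<in> hom G H" and s: "length s = n" "set s \<subseteq> carrier G"
    and w: "w \<in> carrier (free_group n)"
  shows "proj_hom H (map f s) w = f (proj_hom G s w)"
proof -
  have "f \<circ> proj_hom G s \<in> hom (free_group n) H"
    using Group.hom_compose[OF proj_hom_in_hom[OF s] f] .
  then show ?thesis
    using group.proj_hom_unique[of H "f \<circ> proj_hom G s" n "map f s" w] assms
    by (simp add: proj_hom_free_gen)
qed


section \<open>Homogeneity through kernels\<close>

text \<open>The inclusion makes \<open>\<pi>\<^sub>r\<close> factor through \<open>\<pi>\<^sub>s\<close>. As \<open>r\<close> generates \<open>G\<close>, the factor is a surjective
  endomorphism, and finiteness makes it bijective; so one inclusion of kernels is enough.\<close>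

lemma automorphism_if_kernel_le:
  assumes fin: "finite (carrier G)"
    and s: "s \<in> generating_sequences n G" and r: "r \<in> generating_sequences n G"
    and ker: "kernel (free_group n) G (proj_hom G s) \<subseteq> kernel (free_group n) G (proj_hom G r)"
  obtains f where "f \<in> auto G" "map f s = r"
proof -
  have s': "length s = n" "set s \<subseteq> carrier G" and r': "length r = n" "set r \<subseteq> carrier G"
    using s r by (auto simp: generating_sequences_def)
  obtain f where f: "f \<in> hom G G"
    and comp: "\<And>w. w \<in> carrier (free_group n) \<Longrightarrow> f (proj_hom G s w) = proj_hom G r w"
    using hom_factors_through_surjection[OF group_free_group group_axioms group_axioms
        proj_hom_in_hom[OF s'] proj_hom_surj[OF s] proj_hom_in_hom[OF r'] ker] by blast
  have "f ` carrier G = proj_hom G r ` carrier (free_group n)"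
    using comp by (simp add: proj_hom_surj[OF s, symmetric] image_image)
  then have "f ` carrier G = carrier G"
    using proj_hom_surj[OF r] by simp
  then have bij: "bij_betw f (carrier G) (carrier G)"
    using fin by (simp add: bij_betw_def eq_card_imp_inj_on)
  \<comment> \<open>Automorphisms are required to be extensional functions, so \<open>f\<close> has to be restricted.\<close>
  have "restrict f (carrier G) \<in> auto G"
    using bij f by (auto simp: auto_def Bij_def hom_def)
  moreover have "map (restrict f (carrier G)) s = r"
  proof (rule nth_equalityI)
    fix i assume "i < length (map (restrict f (carrier G)) s)"
    then have i: "i < n"
      using s' by simp
    then have "s ! i \<in> carrier G"
      using s' nth_mem by blast
    then show "map (restrict f (carrier G)) s ! i = r ! i"
      using comp[OF free_gen_closed[OF i]] i s' r' by (simp add: proj_hom_free_gen)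
  qed (simp add: s' r')
  ultimately show thesis
    using that by blast
qed

lemma homogeneous_of_rank_if_kernels_le:
  assumes fin: "finite (carrier G)" and r: "r \<in> generating_sequences n G"
    and ker: "\<And>s. s \<in> generating_sequences n G \<Longrightarrow>
      kernel (free_group n) G (proj_hom G s) \<subseteq> kernel (free_group n) G (proj_hom G r)"
  shows "homogeneous_of_rank n G"
proof -
  let ?S = "generating_sequences n G" and ?\<phi> = "aut_action n G"
  interpret group_action "AutoGroup G" ?S ?\<phi>
    by (rule group_action_aut_action)
  have to_r: "r \<in> orbit (AutoGroup G) ?\<phi> s" if s: "s \<in> ?S" for s
  proof -
    obtain f where "f \<in> auto G" "map f s = r"
      using automorphism_if_kernel_le[OF fin s r ker[OF s]] .
    then show ?thesis
      using s by (force simp: orbit_def aut_action_def AutoGroup_def)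
  qed
  have "\<exists>g\<in>carrier (AutoGroup G). ?\<phi> g s = t" if s: "s \<in> ?S" and t: "t \<in> ?S" for s t
  proof -
    have "t \<in> orbit (AutoGroup G) ?\<phi> s"
      using orbit_trans[OF s r t to_r[OF s] orbit_sym[OF t r to_r[OF t]]] .
    then show ?thesis
      by (auto simp: orbit_def)
  qed
  then have "transitive_action (AutoGroup G) ?S ?\<phi>"
    by unfold_locales
  then show ?thesis
    using fin r group_axioms by (auto simp: homogeneous_of_rank_def)
qed

end


section \<open>The homogeneous cover\<close>

text \<open>The counting argument. The hypothesis provides a homomorphism \<open>\<phi>\<^sub>t\<close> from \<open>H\<close> to \<open>G\<close> with
  \<open>\<pi>\<^sub>t = \<phi>\<^sub>t \<circ> \<pi>\<^sub>r\<close>; then \<open>t \<mapsto> map \<phi>\<^sub>t s\<close> permutes the finite set of generating sequences of \<open>G\<close>, so that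
  every \<open>\<pi>\<^sub>u\<close> also factors through \<open>\<pi>\<^sub>s\<close>.\<close>

lemma kernel_le_of_lifts:
  assumes "group G" "finite (carrier G)" "group H"
    and r: "r \<in> generating_sequences n H"
    and lift: "\<And>t. t \<in> generating_sequences n G \<Longrightarrow>
      kernel (free_group n) H (proj_hom H r) \<subseteq> kernel (free_group n) G (proj_hom G t)"
    and s: "s \<in> generating_sequences n H" and u: "u \<in> generating_sequences n G"
  shows "kernel (free_group n) H (proj_hom H s) \<subseteq> kernel (free_group n) G (proj_hom G u)"
proof -
  interpret G: group G by fact
  interpret H: group H by fact
  let ?F = "carrier (free_group n)" and ?S = "generating_sequences n G"
  have s': "length s = n" "set s \<subseteq> carrier H" and r': "length r = n" "set r \<subseteq> carrier H"
    using s r by (auto simp: generating_sequences_def)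
  have G: "length t = n" "set t \<subseteq> carrier G" if "t \<in> ?S" for t
    using that by (auto simp: generating_sequences_def)
  have "\<exists>f. f \<in> hom H G \<and> (\<forall>w\<in>?F. f (proj_hom H r w) = proj_hom G t w)" if t: "t \<in> ?S" for t
    by (rule hom_factors_through_surjection[OF group_free_group H.group_axioms G.group_axioms
          H.proj_hom_in_hom[OF r'] H.proj_hom_surj[OF r] G.proj_hom_in_hom[OF G[OF t]] lift[OF t]])
      auto
  then obtain \<phi> where \<phi>: "\<And>t. t \<in> ?S \<Longrightarrow> \<phi> t \<in> hom H G"
    and \<phi>_comp: "\<And>t w. t \<in> ?S \<Longrightarrow> w \<in> ?F \<Longrightarrow> \<phi> t (proj_hom H r w) = proj_hom G t w"
    by metis
  have \<phi>_s: "proj_hom G (map (\<phi> t) s) w = \<phi> t (proj_hom H s w)" if "t \<in> ?S" "w \<in> ?F" for t w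
    using H.proj_hom_map[OF G.group_axioms \<phi>[OF that(1)] s' that(2)] .
  define \<Phi> where "\<Phi> t = map (\<phi> t) s" for t
  have "\<Phi> ` ?S \<subseteq> ?S"
  proof
    fix v assume "v \<in> \<Phi> ` ?S"
    then obtain t where t: "t \<in> ?S" "v = \<Phi> t"
      by blast
    have "\<phi> t ` carrier H = proj_hom G t ` ?F"
      using \<phi>_comp[OF t(1)] by (simp add: H.proj_hom_surj[OF r, symmetric] image_image)
    then have "\<phi> t ` carrier H = carrier G"
      using G.proj_hom_surj[OF t(1)] by simp
    then show "v \<in> ?S"
      unfolding t \<Phi>_def
      by (rule hom_map_generating_sequences[OF H.group_axioms G.group_axioms \<phi>[OF t(1)] _ s])
  qed
  moreover have "inj_on \<Phi> ?S"
  proof (rule inj_onI)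
    fix t v assume t: "t \<in> ?S" and v: "v \<in> ?S" and eq: "\<Phi> t = \<Phi> v"
    have agree: "\<phi> t h = \<phi> v h" if "h \<in> carrier H" for h
    proof -
      obtain w where "w \<in> ?F" "h = proj_hom H s w"
        using \<open>h \<in> carrier H\<close> H.proj_hom_surj[OF s] by blast
      then show ?thesis
        using \<phi>_s[OF t, of w] \<phi>_s[OF v, of w] eq unfolding \<Phi>_def by metis
    qed
    show "t = v"
    proof (rule nth_equalityI)
      fix i assume "i < length t"
      then have i: "i < n"
        using G[OF t] by simp
      have "r ! i \<in> carrier H"
        using i r' nth_mem by blast
      then show "t ! i = v ! i"
        using \<phi>_comp[OF t free_gen_closed[OF i]] \<phi>_comp[OF v free_gen_closed[OF i]] agree i
          r' G[OF t] G[OF v]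
        by (simp add: G.proj_hom_free_gen H.proj_hom_free_gen)
    qed (use G[OF t] G[OF v] in simp)
  qed
  ultimately have "\<Phi> ` ?S = ?S"
    using G.finite_generating_sequences[OF assms(2)] by (intro endo_inj_surj)
  then obtain t where t: "t \<in> ?S" "u = \<Phi> t"
    using u by blast
  interpret \<phi>: group_hom H G "\<phi> t"
    by unfold_locales (rule \<phi>[OF t(1)])
  show ?thesis
    using \<phi>_s[OF t(1)] \<phi>.hom_one by (auto simp: kernel_def t(2) \<Phi>_def)
qed

lemma normal_Inter:
  assumes "group F" "A \<noteq> {}" "\<And>N. N \<in> A \<Longrightarrow> N \<lhd> F"
  shows "\<Inter>A \<lhd> F"
proof -
  interpret F: group F by fact
  have "subgroup (\<Inter>A) F"
    using assms by (intro F.subgroups_Inter) (auto simp: F.normal_inv_iff)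
  then show ?thesis
    using assms by (simp add: F.normal_inv_iff)
qed

lemma cover_kernel_normal:
  assumes "group G" "generating_sequences n G \<noteq> {}"
  shows "cover_kernel n G (generating_sequences n G) \<lhd> free_group n"
  unfolding cover_kernel_def
proof (rule normal_Inter[OF group_free_group])
  fix N assume "N \<in> (\<lambda>s. kernel (free_group n) G (proj_hom G s)) ` generating_sequences n G"
  then obtain s where s: "length s = n" "set s \<subseteq> carrier G"
    and N: "N = kernel (free_group n) G (proj_hom G s)"
    by (auto simp: generating_sequences_def)
  have "group_hom (free_group n) G (proj_hom G s)"
    using assms(1) group.proj_hom_in_hom[OF assms(1) s]
    by (simp add: group_hom_def group_hom_axioms_def group_free_group)
  then show "N \<lhd> free_group n"
    unfolding N by (rule group_hom.normal_kernel)
qed (use assms in simp)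

text \<open>Two words on which all the \<open>\<pi>\<^sub>t\<close> agree lie in the same coset, so a coset is determined by a
  function from the finite set of generating sequences to \<open>G\<close>.\<close>

lemma finite_cover:
  assumes "group G" "finite (carrier G)" "generating_sequences n G \<noteq> {}"
  shows "finite (carrier (free_group n Mod cover_kernel n G (generating_sequences n G)))"
proof -
  interpret G: group G by fact
  let ?F = "free_group n" and ?S = "generating_sequences n G"
  let ?K = "cover_kernel n G ?S"
  interpret K: normal ?K ?F
    by (rule cover_kernel_normal[OF assms(1,3)])
  have hom: "group_hom ?F G (proj_hom G t)" if "t \<in> ?S" for t
    using that G.proj_hom_in_hom[of t n]
    by (simp add: group_hom_def group_hom_axioms_def group_free_group generating_sequences_def)
  define val where "val w = (\<lambda>t\<in>?S. proj_hom G t w)" for w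
  have fin: "finite (val ` carrier ?F)"
  proof (rule finite_subset)
    show "val ` carrier ?F \<subseteq> (\<Pi>\<^sub>E t\<in>?S. carrier G)"
      by (auto simp: val_def dest: group_hom.hom_closed[OF hom])
    show "finite (\<Pi>\<^sub>E t\<in>?S. carrier G)"
      using assms(2) G.finite_generating_sequences by (intro finite_PiE)
  qed
  have same: "?K #>\<^bsub>?F\<^esub> v = ?K #>\<^bsub>?F\<^esub> w"
    if v: "v \<in> carrier ?F" and w: "w \<in> carrier ?F" and eq: "val v = val w" for v w
  proof -
    have "v \<otimes>\<^bsub>?F\<^esub> inv\<^bsub>?F\<^esub> w \<in> kernel ?F G (proj_hom G t)" if t: "t \<in> ?S" for t
    proof -
      interpret t: group_hom ?F G "proj_hom G t"
        by (rule hom[OF t])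
      have "proj_hom G t v = proj_hom G t w"
        using fun_cong[OF eq, of t] t by (simp add: val_def)
      then show ?thesis
        using v w by (simp add: kernel_def)
    qed
    then have "v \<otimes>\<^bsub>?F\<^esub> inv\<^bsub>?F\<^esub> w \<in> ?K"
      by (simp add: cover_kernel_def)
    then have "v \<in> ?K #>\<^bsub>?F\<^esub> w"
      using v w K.rcos_module_rev[OF K.is_group] by blast
    then show ?thesis
      using K.repr_independence[OF _ w K.is_subgroup] by simp
  qed
  have "(\<lambda>w. ?K #>\<^bsub>?F\<^esub> w) ` carrier ?F
      \<subseteq> (\<lambda>c. ?K #>\<^bsub>?F\<^esub> inv_into (carrier ?F) val c) ` val ` carrier ?F"
  proof
    fix C assume "C \<in> (\<lambda>w. ?K #>\<^bsub>?F\<^esub> w) ` carrier ?F"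
    then obtain w where w: "w \<in> carrier ?F" "C = ?K #>\<^bsub>?F\<^esub> w"
      by blast
    have "C = ?K #>\<^bsub>?F\<^esub> inv_into (carrier ?F) val (val w)"
      unfolding w(2) using w(1) by (intro same) (auto simp: inv_into_into f_inv_into_f)
    then show "C \<in> (\<lambda>c. ?K #>\<^bsub>?F\<^esub> inv_into (carrier ?F) val c) ` val ` carrier ?F"
      using w by blast
  qed
  moreover have "carrier (?F Mod ?K) = (\<lambda>w. ?K #>\<^bsub>?F\<^esub> w) ` carrier ?F"
    by (auto simp: FactGroup_def RCOSETS_def)
  ultimately show ?thesis
    using fin by (simp add: finite_subset)
qed

text \<open>By uniqueness of \<open>\<pi>\<^sub>r\<close>, the homomorphism attached to the cosets of the free generators is the
  quotient map itself; both claims are read off from it.\<close>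

lemma free_quotient_generators:
  assumes "K \<lhd> free_group n"
  defines "r \<equiv> map (\<lambda>i. K #>\<^bsub>free_group n\<^esub> free_gen i) [0..<n]"
  shows free_quotient_generators_generate: "r \<in> generating_sequences n (free_group n Mod K)"
    and free_quotient_generators_kernel:
      "kernel (free_group n) (free_group n Mod K) (proj_hom (free_group n Mod K) r) = K"
proof -
  let ?F = "free_group n"
  let ?H = "?F Mod K"
  interpret K: normal K ?F by fact
  interpret H: group ?H
    by (rule K.factorgroup_is_group)
  have carrier: "carrier ?H = (\<lambda>w. K #>\<^bsub>?F\<^esub> w) ` carrier ?F"
    by (auto simp: FactGroup_def RCOSETS_def)
  have r: "length r = n" "set r \<subseteq> carrier ?H"
    by (auto simp: r_def carrier free_gen_closed)
  have proj: "proj_hom ?H r w = K #>\<^bsub>?F\<^esub> w" if "w \<in> carrier ?F" for w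
    using H.proj_hom_unique[OF K.r_coset_hom_Mod _ that, of r] by (simp add: r_def)
  then have "proj_hom ?H r ` carrier ?F = carrier ?H"
    by (simp add: carrier)
  then show "r \<in> generating_sequences n ?H"
    using r H.proj_hom_image[OF r] by (simp add: generating_sequences_def)
  have "K #>\<^bsub>?F\<^esub> w = K \<longleftrightarrow> w \<in> K" if "w \<in> carrier ?F" for w
    using that K.coset_join1 K.coset_join2 K.is_subgroup K.subset by metis
  then show "kernel ?F ?H (proj_hom ?H r) = K"
    using proj K.subset by (auto simp: kernel_def FactGroup_def)
qed

theorem proposition4p6:
  fixes G :: "('a, 'b) monoid_scheme" and n :: nat and R :: "'a list set"
  assumes "group G" and "finite (carrier G)"
    and "n > 0"
    and "generating_sequences n G \<noteq> {}"
    and "orbit_representatives n G R"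
  shows "homogeneous_of_rank n (homogeneous_cover n G R)"
proof -
  let ?F = "free_group n" and ?S = "generating_sequences n G"
  define K where "K = cover_kernel n G ?S"
  have cover: "homogeneous_cover n G R = ?F Mod K"
    using group.cover_kernel_eq[OF assms(1,5)] by (simp add: homogeneous_cover_def K_def)
  have K: "K \<lhd> ?F"
    unfolding K_def by (rule cover_kernel_normal[OF assms(1,4)])
  interpret H: group "?F Mod K"
    by (rule normal.factorgroup_is_group[OF K])
  obtain r where r: "r \<in> generating_sequences n (?F Mod K)"
    and ker_r: "kernel ?F (?F Mod K) (proj_hom (?F Mod K) r) = K"
    using free_quotient_generators_generate[OF K] free_quotient_generators_kernel[OF K] by blast
  have K_le: "K \<subseteq> kernel ?F G (proj_hom G t)" if "t \<in> ?S" for t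
    using that by (auto simp: K_def cover_kernel_def)
  have "homogeneous_of_rank n (?F Mod K)"
  proof (rule H.homogeneous_of_rank_if_kernels_le[OF _ r])
    show "finite (carrier (?F Mod K))"
      unfolding K_def by (rule finite_cover[OF assms(1,2,4)])
  next
    fix s assume s: "s \<in> generating_sequences n (?F Mod K)"
    have "kernel ?F (?F Mod K) (proj_hom (?F Mod K) s) \<subseteq> kernel ?F G (proj_hom G u)"
      if "u \<in> ?S" for u
      using kernel_le_of_lifts[OF assms(1,2) H.group_axioms r _ s that] K_le by (simp add: ker_r)
    then show "kernel ?F (?F Mod K) (proj_hom (?F Mod K) s)
        \<subseteq> kernel ?F (?F Mod K) (proj_hom (?F Mod K) r)"
      unfolding ker_r by (auto simp: K_def cover_kernel_def)
  qed
  then show ?thesis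
    by (simp add: cover)
qed

end
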